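(* Let $G=(V,E)$, node centralities $(C_x)_{x\in V}$, edge importances $C$ and spurious importances $C_s$ be as in the context, let $G_{2\text{-hop}}=(V,F)$ with weights $w(a,c)=C_a+C_c$, and let $H$ be the list of edges of a minimum spanning forest of $G_{2\text{-hop}}$ in nondecreasing order of weight. Then for every utility threshold $\tau$ there exists an ordering $L$ of all of $F$ in nondecreasing order of weight such that the greedy merging procedure with candidate list $H$ and threshold $\tau$ outputs the same summary as the greedy merging procedure with candidate list $L$ and threshold $\tau$.
   Context: $G=(V,E)$ is a finite simple undirected graph. Edge importances $C(u,v)>0$ for $\{u,v\}\in E$ sum to $1$; spurious importances $C_s(u,v)\ge0$ for non-adjacent distinct pairs $\{u,v\}$ sum to $1$. $F=\{\{a,c\}: a\neq c,\ \exists b \text{ with } \{a,b\},\{b,c\}\in E\}$ (pairs at the end of a path of length two), $G_{2\text{-hop}}=(V,F)$, weighted by $w(a,c)=C_a+C_c$. For a partition $\mathcal{V}$ of $V$ (supernodes) and supernodes $X,Y$ (possibly equal), let $\mathrm{nSedge}(X,Y)$ be the sum of $C(x,y)$ over edges $\{x,y\}\in E$ with $x\in X$, $y\in Y$ (for $X=Y$: over unordered pairs of distinct nodes of $X$), and $\mathrm{Sedge}(X,Y)$ the analogous sum of $C_s(x,y)$ over non-adjacent pairs. The summary of $\mathcal{V}$ has superedge $\{X,Y\}$ iff some edge of $G$ joins $X$ and $Y$ (lies inside $X$ if $X=Y$) and $\mathrm{Sedge}(X,Y)\le \mathrm{nSedge}(X,Y)$; its utility is $u(\mathcal{V})=\sum_{\{X,Y\}\text{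 superedge}}(\mathrm{nSedge}(X,Y)-\mathrm{Sedge}(X,Y))$. Greedy merging procedure with candidate list $M=(m_1,\dots,m_N)$ of pairs and threshold $\tau$: $P_0$ is the partition into singletons; $P_t$ is obtained from $P_{t-1}$ by merging the parts containing the two endpoints of $m_t$ (unchanged if they already share a part). If some $t$ has $u(P_t)<\tau$, let $t_0$ be the least such and output the summary of $P_{t_0-1}$; otherwise output the summary of $P_N$. *)

theory Defs
  imports Complex_Main
begin

text \<open>
  Graphs are undirected and simple: a vertex set together with a set of two-element
  subsets of it.  An unordered pair of vertices is its two-element set, so edge
  importances, spurious importances and pair weights are functions on \<^typ>\<open>'a set\<close>.
\<close>

definition simple_graph :: "'a set \<Rightarrow> 'a set set \<Rightarrow> bool" where
  "simple_graph V E \<longleftrightarrow> finite V \<and> (\<forall>e\<in>E. e \<subseteq> V \<and> card e = 2)"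

definition nonadjacent_pairs :: "'a set \<Rightarrow> 'a set set \<Rightarrow> 'a set set" where
  "nonadjacent_pairs V E = {{u, v} | u v. u \<in> V \<and> v \<in> V \<and> u \<noteq> v \<and> {u, v} \<notin> E}"

definition two_hop :: "'a set set \<Rightarrow> 'a set set" where
  "two_hop E = {{a, c} | a c. a \<noteq> c \<and> (\<exists>b. {a, b} \<in> E \<and> {b, c} \<in> E)}"

definition pair_weight :: "('a \<Rightarrow> real) \<Rightarrow> 'a set \<Rightarrow> real" where
  "pair_weight cen e = (\<Sum>x\<in>e. cen x)"

lemma pair_weight_pair: "a \<noteq> c \<Longrightarrow> pair_weight cen {a, c} = cen a + cen c"
  by (simp add: pair_weight_def)


subsection \<open>Minimum spanning forests\<close>

definition is_cycle :: "'a set set \<Rightarrow> 'a list \<Rightarrow> bool" where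
  "is_cycle T vs \<longleftrightarrow> 3 \<le> length vs \<and> distinct vs \<and>
     (\<forall>i < length vs. {vs ! i, vs ! (Suc i mod length vs)} \<in> T)"

definition connected_by :: "'a set set \<Rightarrow> 'a \<Rightarrow> 'a \<Rightarrow> bool" where
  "connected_by T = (\<lambda>u v. {u, v} \<in> T)\<^sup>*\<^sup>*"

text \<open>
  A spanning forest of a graph with edge set \<open>F\<close> consists of one spanning tree for each
  connected component: it is acyclic and has the same connected components.
\<close>

definition spanning_forest :: "'a set set \<Rightarrow> 'a set set \<Rightarrow> bool" where
  "spanning_forest F T \<longleftrightarrow> T \<subseteq> F \<and> (\<nexists>vs. is_cycle T vs) \<and> connected_by T = connected_by F"

definition minimum_spanning_forest :: "'a set set \<Rightarrow> ('a set \<Rightarrow> real) \<Rightarrow> 'a set set \<Rightarrow> bool" where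
  "minimum_spanning_forest F w T \<longleftrightarrow> spanning_forest F T \<and>
     (\<forall>T'. spanning_forest F T' \<longrightarrow> (\<Sum>e\<in>T. w e) \<le> (\<Sum>e\<in>T'. w e))"


subsection \<open>Summaries and their utility\<close>

text \<open>
  A possibly degenerate pair of supernodes \<open>X\<close>, \<open>Y\<close> is represented by the set \<open>{X, Y}\<close>,
  which is \<open>{X}\<close> for \<open>X = Y\<close>.
\<close>

definition pairs_between :: "'a set set \<Rightarrow> 'a set set" where
  "pairs_between S = {{x, y} | x y. x \<noteq> y \<and> (\<exists>X Y. S = {X, Y} \<and> x \<in> X \<and> y \<in> Y)}"

lemma pairs_between_doubleton:
  "pairs_between {X, Y} = {{x, y} | x y. x \<in> X \<and> y \<in> Y \<and> x \<noteq> y}"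
  unfolding pairs_between_def by (auto simp: doubleton_eq_iff)

definition nSedge :: "'a set set \<Rightarrow> ('a set \<Rightarrow> real) \<Rightarrow> 'a set set \<Rightarrow> real" where
  "nSedge E C S = (\<Sum>e \<in> E \<inter> pairs_between S. C e)"

definition Sedge :: "'a set \<Rightarrow> 'a set set \<Rightarrow> ('a set \<Rightarrow> real) \<Rightarrow> 'a set set \<Rightarrow> real" where
  "Sedge V E Cs S = (\<Sum>e \<in> nonadjacent_pairs V E \<inter> pairs_between S. Cs e)"

definition superedges ::
  "'a set \<Rightarrow> 'a set set \<Rightarrow> ('a set \<Rightarrow> real) \<Rightarrow> ('a set \<Rightarrow> real) \<Rightarrow> 'a set set \<Rightarrow> 'a set set set" where
  "superedges V E C Cs P =
     {{X, Y} | X Y. X \<in> P \<and> Y \<in> P \<and> E \<inter> pairs_between {X, Y} \<noteq> {} \<and>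
        Sedge V E Cs {X, Y} \<le> nSedge E C {X, Y}}"

definition summary ::
  "'a set \<Rightarrow> 'a set set \<Rightarrow> ('a set \<Rightarrow> real) \<Rightarrow> ('a set \<Rightarrow> real) \<Rightarrow> 'a set set
     \<Rightarrow> 'a set set \<times> 'a set set set" where
  "summary V E C Cs P = (P, superedges V E C Cs P)"

definition utility ::
  "'a set \<Rightarrow> 'a set set \<Rightarrow> ('a set \<Rightarrow> real) \<Rightarrow> ('a set \<Rightarrow> real) \<Rightarrow> 'a set set \<Rightarrow> real" where
  "utility V E C Cs P = (\<Sum>S \<in> superedges V E C Cs P. nSedge E C S - Sedge V E Cs S)"


subsection \<open>Greedy merging\<close>

text \<open>
  \<open>merge P m\<close> replaces the parts meeting the pair \<open>m\<close> by their union; if both endpoints of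
  \<open>m\<close> lie in one part, the partition is unchanged.
\<close>

definition merge :: "'a set set \<Rightarrow> 'a set \<Rightarrow> 'a set set" where
  "merge P m = insert (\<Union>{X \<in> P. X \<inter> m \<noteq> {}}) {X \<in> P. X \<inter> m = {}}"

definition partition_after :: "'a set \<Rightarrow> 'a set list \<Rightarrow> nat \<Rightarrow> 'a set set" where
  "partition_after V M t = foldl merge ((\<lambda>v. {v}) ` V) (take t M)"

text \<open>
  The utility is tested after each merge, so the step at which it first drops below the
  threshold is at least 1 and \<open>t\<^sub>0 - 1\<close> involves no truncation.
\<close>

definition greedy_summary ::
  "'a set \<Rightarrow> 'a set set \<Rightarrow> ('a set \<Rightarrow> real) \<Rightarrow> ('a set \<Rightarrow> real) \<Rightarrow> 'a set list \<Rightarrow> real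
     \<Rightarrow> 'a set set \<times> 'a set set set" where
  "greedy_summary V E C Cs M \<tau> =
     (let below = (\<lambda>t. t \<in> {1..length M} \<and> utility V E C Cs (partition_after V M t) < \<tau>) in
      if \<exists>t. below t
      then summary V E C Cs (partition_after V M ((LEAST t. below t) - 1))
      else summary V E C Cs (partition_after V M (length M)))"

end

(*
  A pair of L outside the forest joins two nodes that are already connected by forest edges
  of no larger weight: otherwise exchanging it for a heavier edge of the forest path between
  its endpoints would give a lighter spanning forest.  If forest edges come first among pairs
  of equal weight, merging along such a pair therefore changes nothing, so the partitions
  produced by L are those produced by H with repetitions.  The initial partition is not
  repeated, which matters because its utility is not compared with the threshold.
*)
theory Submission
  imports Defs "HOL-Library.Product_Lexorder"
begin

section \<open>Connectivity\<close>

lemma connected_by_refl [simp]: "connected_by T x x"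
  by (simp add: connected_by_def)

lemma connected_by_edge: "{x, y} \<in> T \<Longrightarrow> connected_by T x y"
  by (auto simp: connected_by_def)

lemma connected_by_trans: "connected_by T x y \<Longrightarrow> connected_by T y z \<Longrightarrow> connected_by T x z"
  by (auto simp: connected_by_def)

lemma connected_by_sym: "connected_by T x y \<Longrightarrow> connected_by T y x"
  unfolding connected_by_def
  by (rule sympD[OF symp_rtranclp]) (auto simp: symp_def insert_commute)

lemma connected_by_subst:
  assumes "\<And>x y. {x, y} \<in> S \<Longrightarrow> connected_by T x y" and "connected_by S x y"
  shows "connected_by T x y"
  using assms(2) unfolding connected_by_def
proof (induction rule: rtranclp_induct)
  case (step y z)
  then show ?case
    using assms(1) unfolding connected_by_def by (metis (no_types, lifting) rtranclp_trans)
qed simp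

lemma connected_by_mono: "S \<subseteq> T \<Longrightarrow> connected_by S x y \<Longrightarrow> connected_by T x y"
  by (rule connected_by_subst[of S]) (auto intro: connected_by_edge)

text \<open>A walk can be shortened until it uses the new edge at most once, in one of its two
  directions. All later additions and deletions of a single edge are analysed through this
  equivalence.\<close>

lemma connected_by_insert:
  "connected_by (insert {a, b} T) x y \<longleftrightarrow>
     connected_by T x y \<or> connected_by T x a \<and> connected_by T b y \<or>
     connected_by T x b \<and> connected_by T a y" (is "?L \<longleftrightarrow> ?R")
proof
  assume ?L
  then show ?R
    unfolding connected_by_def[of "insert _ _"]
  proof (induction rule: rtranclp_induct)
    case (step y z)
    consider "{y, z} \<in> T" | "y = a" "z = b" | "y = b" "z = a"
      using step.hyps(2) by (auto simp: doubleton_eq_iff)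
    then show ?case
    proof cases
      case 1
      then show ?thesis using step.IH connected_by_edge connected_by_trans by metis
    next
      case 2
      then show ?thesis using step.IH connected_by_refl connected_by_trans by metis
    next
      case 3
      then show ?thesis using step.IH connected_by_refl connected_by_trans by metis
    qed
  qed simp
next
  let ?T = "insert {a, b} T"
  have "connected_by ?T a b" "connected_by ?T b a"
    by (auto intro!: connected_by_edge simp: insert_commute)
  moreover have "connected_by T u v \<Longrightarrow> connected_by ?T u v" for u v
    by (rule connected_by_mono) auto
  ultimately show "?R \<Longrightarrow> ?L"
    by (meson connected_by_trans)
qed

lemma connected_by_empty: "connected_by {} x y \<longleftrightarrow> x = y"
  by (auto simp: connected_by_def elim: rtranclp.cases)


section \<open>Acyclic edge sets\<close>

text \<open>Acyclicity stated without lists of vertices: every edge is a bridge. A loop violates it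
  too, since \<open>connected_by\<close> is reflexive. This form passes easily to subsets and to
  one-edge extensions.\<close>

definition bridges_only :: "'a set set \<Rightarrow> bool" where
  "bridges_only T \<longleftrightarrow> (\<forall>x y. {x, y} \<in> T \<longrightarrow> \<not> connected_by (T - {{x, y}}) x y)"

lemma simple_path_exists:
  assumes "connected_by T x y"
  shows "\<exists>vs. vs \<noteq> [] \<and> distinct vs \<and> hd vs = x \<and> last vs = y \<and>
           (\<forall>i. Suc i < length vs \<longrightarrow> {vs ! i, vs ! Suc i} \<in> T)"
  using assms unfolding connected_by_def
proof (induction rule: rtranclp_induct)
  case base
  show ?case by (intro exI[of _ "[x]"]) auto
next
  case (step y z)
  then obtain vs where vs: "vs \<noteq> []" "distinct vs" "hd vs = x" "last vs = y"
    and edges: "\<And>i. Suc i < length vs \<Longrightarrow> {vs ! i, vs ! Suc i} \<in> T" by blast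
  show ?case
  proof (cases "z \<in> set vs")
    \<comment> \<open>The path already visits \<open>z\<close>, so it is cut off right after that
      visit instead of being extended.\<close>
    case True
    then obtain k where k: "k < length vs" "vs ! k = z" by (auto simp: in_set_conv_nth)
    then have "last (take (Suc k) vs) = z" by (simp add: take_Suc_conv_app_nth)
    then show ?thesis
      using vs edges by (intro exI[of _ "take (Suc k) vs"]) auto
  next
    case False
    have "{(vs @ [z]) ! i, (vs @ [z]) ! Suc i} \<in> T" if "Suc i < length (vs @ [z])" for i
    proof (cases "Suc i < length vs")
      case True
      then show ?thesis using edges by (simp add: nth_append)
    next
      case False
      then have "i = length vs - 1" "Suc i = length vs" using that by auto
      then show ?thesis
        using vs step.hyps(2) by (simp add: nth_append last_conv_nth)
    qed
    then show ?thesis using vs False by (intro exI[of _ "vs @ [z]"]) auto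
  qed
qed

text \<open>A bypass of an edge, taken as a simple path, would be closed to a cycle by that edge.
  Loops are excluded separately because \<open>is_cycle\<close> demands at least three
  vertices.\<close>

lemma bridges_only_if_acyclic:
  assumes acyclic: "\<nexists>vs. is_cycle T vs" and loopless: "\<And>x. {x} \<notin> T"
  shows "bridges_only T"
  unfolding bridges_only_def
proof (intro allI impI notI)
  fix x y assume xy: "{x, y} \<in> T" and "connected_by (T - {{x, y}}) x y"
  then obtain vs where vs: "vs \<noteq> []" "distinct vs" "hd vs = x" "last vs = y"
    and edges: "\<And>i. Suc i < length vs \<Longrightarrow> {vs ! i, vs ! Suc i} \<in> T - {{x, y}}"
    using simple_path_exists by metis
  have neq: "x \<noteq> y" using xy loopless by auto
  have ends: "vs ! 0 = x" "vs ! (length vs - 1) = y"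
    using vs by (auto simp: hd_conv_nth last_conv_nth)
  have "length vs \<noteq> 0" "length vs \<noteq> 1" using vs(1) ends neq by auto
  \<comment> \<open>With two vertices the only edge of the path would be the deleted edge
    itself.\<close>
  moreover have "length vs \<noteq> 2" using edges[of 0] ends by (auto simp: numeral_2_eq_2)
  ultimately have len: "3 \<le> length vs" by linarith
  have "{vs ! i, vs ! (Suc i mod length vs)} \<in> T" if "i < length vs" for i
  proof (cases "Suc i < length vs")
    case True
    then show ?thesis using edges by simp
  next
    case False
    then have "Suc i = length vs" using that by simp
    moreover from this have "i = length vs - 1" by simp
    ultimately show ?thesis using ends xy by (simp add: insert_commute)
  qed
  then have "is_cycle T vs" unfolding is_cycle_def using vs len by simp
  then show False using acyclic by blast
qed

text \<open>In a cycle, the edge from the last vertex back to the first is bypassed by the remaining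
  edges, so it is not a bridge.\<close>

lemma acyclic_if_bridges_only:
  assumes "bridges_only T"
  shows "\<not> is_cycle T vs"
proof
  assume cyc: "is_cycle T vs"
  define n where "n = length vs - 1"
  have len: "length vs = Suc n" "2 \<le> n" and "distinct vs"
    and edges: "\<And>i. i < length vs \<Longrightarrow> {vs ! i, vs ! (Suc i mod length vs)} \<in> T"
    using cyc by (auto simp: is_cycle_def n_def)
  define T' where "T' = T - {{vs ! 0, vs ! n}}"
  have closing: "{vs ! 0, vs ! n} \<in> T" using edges[of n] len by (simp add: insert_commute)
  have "i \<le> n \<Longrightarrow> connected_by T' (vs ! 0) (vs ! i)" for i
  proof (induction i)
    case (Suc i)
    \<comment> \<open>Distinctness alone would not do: \<open>2 \<le> n\<close> keeps the step from
      index 0 to 1 apart from the closing edge.\<close>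
    have "{vs ! i, vs ! Suc i} \<noteq> {vs ! 0, vs ! n}"
      using Suc.prems len \<open>distinct vs\<close> by (auto simp: doubleton_eq_iff nth_eq_iff_index_eq)
    then have "connected_by T' (vs ! i) (vs ! Suc i)"
      using edges[of i] Suc.prems len by (intro connected_by_edge) (simp add: T'_def)
    then show ?case using Suc connected_by_trans by (metis Suc_leD)
  qed simp
  then show False using assms closing unfolding bridges_only_def T'_def by blast
qed

lemma bridges_only_subset:
  assumes "bridges_only T" and "S \<subseteq> T"
  shows "bridges_only S"
  unfolding bridges_only_def
proof (intro allI impI notI)
  fix x y assume "{x, y} \<in> S" "connected_by (S - {{x, y}}) x y"
  then show False
    using assms connected_by_mono[of "S - {{x, y}}" "T - {{x, y}}" x y]
    unfolding bridges_only_def by blast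
qed

text \<open>A bypass of an old edge would have to use the new edge. Its two remaining halves
  together with the old edge would then join \<open>a\<close> to \<open>c\<close> inside
  \<open>T\<close>.\<close>

lemma bridges_only_insert:
  assumes T: "bridges_only T" and sep: "\<not> connected_by T a c"
  shows "bridges_only (insert {a, c} T)"
  unfolding bridges_only_def
proof (intro allI impI notI)
  fix p q
  assume pq: "{p, q} \<in> insert {a, c} T"
    and conn: "connected_by (insert {a, c} T - {{p, q}}) p q"
  have acT: "{a, c} \<notin> T" using sep connected_by_edge by metis
  show False
  proof (cases "{p, q} = {a, c}")
    case True
    then have "connected_by T p q" using conn acT by simp
    then show False using True sep connected_by_sym by (metis doubleton_eq_iff)
  next
    case False
    then have inT: "{p, q} \<in> T" using pq by simp
    define S where "S = T - {{p, q}}"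
    have "connected_by (insert {a, c} S) p q"
      using conn False by (simp add: S_def insert_Diff_if)
    moreover have "\<not> connected_by S p q" using T inT by (simp add: bridges_only_def S_def)
    ultimately have "connected_by S p a \<and> connected_by S c q \<or>
        connected_by S p c \<and> connected_by S a q"
      by (simp add: connected_by_insert)
    moreover have "connected_by S u v \<Longrightarrow> connected_by T u v" for u v
      by (rule connected_by_mono) (auto simp: S_def)
    ultimately show False
      using sep connected_by_edge[OF inT] connected_by_sym connected_by_trans by metis
  qed
qed


section \<open>The exchange property of minimum spanning forests\<close>

text \<open>Delete the members of \<open>B\<close> one at a time; the first one to separate \<open>a\<close> from \<open>c\<close>
  also does so when deleted alone, since it is a bridge.\<close>

lemma separating_edge_exists:
  assumes "finite B" and "bridges_only T" and "connected_by T a c"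
    and "\<not> connected_by (T - B) a c" and pairs: "\<forall>e\<in>T. card e = 2"
  shows "\<exists>f\<in>B \<inter> T. \<not> connected_by (T - {f}) a c"
  using assms(1,4)
proof (induction B rule: finite_induct)
  case empty
  then show ?case using assms(3) by simp
next
  case (insert f B)
  show ?case
  proof (cases "connected_by (T - B) a c")
    case False
    then show ?thesis using insert.IH by blast
  next
    case True
    have sep: "\<not> connected_by (T - insert f B) a c" by (rule insert.prems)
    have "f \<in> T"
    proof (rule ccontr)
      assume "f \<notin> T"
      then have "T - insert f B = T - B" by blast
      then show False using True sep by simp
    qed
    then obtain x y where f: "f = {x, y}" using pairs by (meson card_2_iff)
    have "T - B = insert {x, y} (T - insert f B)"
      using \<open>f \<in> T\<close> insert.hyps f by blast
    \<comment> \<open>Restoring \<open>f\<close> reconnects \<open>a\<close> and \<open>c\<close>,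
      so the walk crosses \<open>f\<close>, and its two halves avoid \<open>f\<close>.\<close>
    then have "connected_by (T - insert f B) a x \<and> connected_by (T - insert f B) y c \<or>
        connected_by (T - insert f B) a y \<and> connected_by (T - insert f B) x c"
      using True sep by (metis connected_by_insert)
    then have ends: "connected_by (T - {f}) a x \<and> connected_by (T - {f}) y c \<or>
        connected_by (T - {f}) a y \<and> connected_by (T - {f}) x c"
      using connected_by_mono[of "T - insert f B" "T - {f}"] by blast
    \<comment> \<open>Otherwise the two halves and this connection would join the ends of
      \<open>f\<close> without \<open>f\<close>, which is a bridge.\<close>
    have "\<not> connected_by (T - {f}) a c"
    proof
      assume "connected_by (T - {f}) a c"
      with ends have "connected_by (T - {f}) x y"
        by (elim disjE conjE) (meson connected_by_sym connected_by_trans)+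
      then show False using assms(2) \<open>f \<in> T\<close> f by (simp add: bridges_only_def)
    qed
    then show ?thesis using \<open>f \<in> T\<close> by blast
  qed
qed

text \<open>Exchange argument: if the light edges fail to connect \<open>a\<close> and
  \<open>c\<close>, some strictly heavier forest edge separates them on its own, and replacing it by
  \<open>{a, c}\<close> gives a spanning forest of smaller total weight.\<close>

lemma minimum_spanning_forest_connects_light:
  fixes w :: "'a set \<Rightarrow> real"
  assumes msf: "minimum_spanning_forest F w T" and "finite F"
    and pairs: "\<forall>e\<in>F. card e = 2" and acF: "{a, c} \<in> F"
  shows "connected_by {f \<in> T. w f \<le> w {a, c}} a c"
proof (rule ccontr)
  assume sep: "\<not> connected_by {f \<in> T. w f \<le> w {a, c}} a c"
  have TF: "T \<subseteq> F" and acyclic: "\<nexists>vs. is_cycle T vs"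
    and conn: "connected_by T = connected_by F"
    and min: "\<And>T'. spanning_forest F T' \<Longrightarrow> sum w T \<le> sum w T'"
    using msf by (auto simp: minimum_spanning_forest_def spanning_forest_def)
  have "finite T" using TF \<open>finite F\<close> finite_subset by blast
  have "{x} \<notin> T" for x using TF pairs by fastforce
  then have bridges: "bridges_only T" using bridges_only_if_acyclic[OF acyclic] by blast
  have acT: "connected_by T a c" using conn acF connected_by_edge by metis
  let ?B = "{f \<in> T. w f > w {a, c}}"
  have "T - ?B = {f \<in> T. w f \<le> w {a, c}}" by auto
  then obtain f where f: "f \<in> ?B" and fsep: "\<not> connected_by (T - {f}) a c"
    using separating_edge_exists[of ?B T a c] sep bridges acT \<open>finite T\<close> TF pairs by auto
  have "card f = 2" using f TF pairs by auto
  then obtain x y where fxy: "f = {x, y}" by (meson card_2_iff)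
  define T' where "T' = insert {a, c} (T - {f})"
  have "T = insert {x, y} (T - {f})" using f fxy by blast
  then have "connected_by (T - {f}) a x \<and> connected_by (T - {f}) y c \<or>
      connected_by (T - {f}) a y \<and> connected_by (T - {f}) x c"
    using acT fsep by (metis connected_by_insert)
  \<comment> \<open>The deleted edge is replaced by the detour through \<open>{a, c}\<close>, so the
    exchange preserves connectivity.\<close>
  then have xy: "connected_by T' x y"
    unfolding T'_def connected_by_insert using connected_by_sym by metis
  have "connected_by T' u v" if "{u, v} \<in> T" for u v
  proof (cases "{u, v} = f")
    case True
    then show ?thesis using xy fxy connected_by_sym by (metis doubleton_eq_iff)
  next
    case False
    then show ?thesis using that by (intro connected_by_edge) (simp add: T'_def)
  qed
  then have "connected_by F u v \<Longrightarrow> connected_by T' u v" for u v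
    using connected_by_subst conn by metis
  moreover have T'F: "T' \<subseteq> F" using TF acF by (auto simp: T'_def)
  ultimately have "connected_by T' = connected_by F"
    by (auto simp: fun_eq_iff intro: connected_by_mono)
  moreover have "bridges_only T'"
    unfolding T'_def using bridges fsep
    by (intro bridges_only_insert bridges_only_subset[OF bridges]) auto
  ultimately have "spanning_forest F T'"
    using T'F acyclic_if_bridges_only by (auto simp: spanning_forest_def)
  moreover have "{a, c} \<notin> T - {f}" using fsep connected_by_edge by metis
  then have "sum w T' = w {a, c} + sum w (T - {f})"
    unfolding T'_def using \<open>finite T\<close> by (intro sum.insert) auto
  moreover have "sum w T = w f + sum w (T - {f})"
    using f \<open>finite T\<close> by (intro sum.remove) auto
  ultimately show False using min[of T'] f by simp
qed


section \<open>Merging computes connected components\<close>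

definition components_of :: "'a set \<Rightarrow> 'a set set \<Rightarrow> 'a set set" where
  "components_of V T = (\<lambda>u. {v \<in> V. connected_by T u v}) ` V"

text \<open>The parts meeting \<open>{a, b}\<close> are exactly the classes of \<open>a\<close> and
  \<open>b\<close>, and the new edge unites just these two. If they coincide, both sides leave the
  partition unchanged.\<close>

lemma merge_components_of:
  assumes "a \<in> V" "b \<in> V"
  shows "merge (components_of V T) {a, b} = components_of V (insert {a, b} T)"
proof -
  define old where "old u = {v \<in> V. connected_by T u v}" for u
  define new where "new u = {v \<in> V. connected_by (insert {a, b} T) u v}" for u
  have new_ab: "new u = old a \<union> old b" if "connected_by T u a \<or> connected_by T u b" for u
  proof -
    have "connected_by (insert {a, b} T) u v \<longleftrightarrow> connected_by T a v \<or> connected_by T b v" for v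
      unfolding connected_by_insert
      using that by (metis connected_by_sym connected_by_trans)
    then show ?thesis by (auto simp: new_def old_def)
  qed
  have new_other: "new u = old u" if "\<not> connected_by T u a" "\<not> connected_by T u b" for u
    using that by (simp add: new_def old_def connected_by_insert)
  have old_eq: "old u = old v" if "connected_by T u v" for u v
  proof -
    have "connected_by T u x \<longleftrightarrow> connected_by T v x" for x
      using that by (metis connected_by_sym connected_by_trans)
    then show ?thesis by (simp add: old_def)
  qed
  \<comment> \<open>Classes are cut down to \<open>V\<close>, so \<open>a\<close> and
    \<open>b\<close> must lie in \<open>V\<close> to be found in them.\<close>
  have meets: "old u \<inter> {a, b} \<noteq> {} \<longleftrightarrow> connected_by T u a \<or> connected_by T u b" for u
    unfolding old_def using assms by blast
  have "{X \<in> old ` V. X \<inter> {a, b} \<noteq> {}} =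
      old ` {u \<in> V. connected_by T u a \<or> connected_by T u b}"
    using meets by (auto simp del: Int_insert_right)
  also have "\<dots> = {old a, old b}"
  proof (intro equalityI subsetI)
    show "X \<in> {old a, old b}"
      if "X \<in> old ` {u \<in> V. connected_by T u a \<or> connected_by T u b}" for X
      using that by (auto dest: old_eq)
    show "X \<in> old ` {u \<in> V. connected_by T u a \<or> connected_by T u b}"
      if "X \<in> {old a, old b}" for X
      using that assms by auto
  qed
  finally have "\<Union>{X \<in> old ` V. X \<inter> {a, b} \<noteq> {}} = old a \<union> old b"
    by simp
  then have "merge (old ` V) {a, b} =
      insert (old a \<union> old b) {X \<in> old ` V. X \<inter> {a, b} = {}}"
    by (simp add: merge_def)
  also have "{X \<in> old ` V. X \<inter> {a, b} = {}} =
      old ` {u \<in> V. \<not> connected_by T u a \<and> \<not> connected_by T u b}"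
    using meets by blast
  also have "\<dots> = new ` {u \<in> V. \<not> connected_by T u a \<and> \<not> connected_by T u b}"
    using new_other by (intro image_cong) auto
  also have "insert (old a \<union> old b) \<dots> = new ` V"
  proof (intro equalityI subsetI)
    let ?U = "{u \<in> V. \<not> connected_by T u a \<and> \<not> connected_by T u b}"
    show "X \<in> new ` V" if "X \<in> insert (old a \<union> old b) (new ` ?U)" for X
      using that new_ab[of a] assms(1) by auto
    show "X \<in> insert (old a \<union> old b) (new ` ?U)" if X: "X \<in> new ` V" for X
    proof -
      obtain u where u: "u \<in> V" "X = new u" using X by blast
      show ?thesis
      proof (cases "u \<in> ?U")
        case True
        then show ?thesis using u by simp
      next
        case False
        then have "X = old a \<union> old b" using u new_ab[of u] by simp
        then show ?thesis by simp
      qed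
    qed
  qed
  finally show ?thesis by (simp add: components_of_def old_def new_def)
qed

text \<open>Order and repetition of the merged pairs thus do not affect the resulting partition;
  prefixes of two candidate lists can be compared by connectivity alone.\<close>

lemma foldl_merge:
  assumes "\<forall>e\<in>set M. e \<subseteq> V \<and> card e = 2"
  shows "foldl merge ((\<lambda>v. {v}) ` V) M = components_of V (set M)"
  using assms
proof (induction M rule: rev_induct)
  case Nil
  show ?case by (auto simp: components_of_def connected_by_empty)
next
  case (snoc e M)
  then obtain a b where "e = {a, b}" by (auto simp: card_2_iff)
  then show ?case using snoc by (auto simp: merge_components_of)
qed


section \<open>Stuttering sequences\<close>

text \<open>The stopping rule of the greedy procedure, detached from utilities. Testing starts at
  index 1, so \<open>p 0\<close> is never tested and the subtraction of 1 does not truncate.\<close>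

definition last_before :: "('b \<Rightarrow> bool) \<Rightarrow> (nat \<Rightarrow> 'b) \<Rightarrow> nat \<Rightarrow> 'b" where
  "last_before bad p n =
     (if \<exists>t. t \<in> {1..n} \<and> bad (p t) then p ((LEAST t. t \<in> {1..n} \<and> bad (p t)) - 1) else p n)"

lemma greedy_summary_last_before:
  "greedy_summary V E C Cs M \<tau> = summary V E C Cs
     (last_before (\<lambda>P. utility V E C Cs P < \<tau>) (partition_after V M) (length M))"
  by (auto simp: greedy_summary_def last_before_def Let_def)

text \<open>Here \<open>q\<close> runs through \<open>p\<close> with repetitions, at the pace
  \<open>j\<close>. The first bad time of \<open>q\<close> is sent to the first bad time of
  \<open>p\<close>, and so are their predecessors. The assumption \<open>pos\<close> forbids
  repeating \<open>p 0\<close>: a copy at a positive time would be tested, while \<open>p 0\<close>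
  is not.\<close>

lemma last_before_stutter:
  fixes j :: "nat \<Rightarrow> nat"
  assumes q: "\<And>t. t \<le> n \<Longrightarrow> q t = p (j t)"
    and j0: "j 0 = 0" and jn: "j n = m" and pos: "\<And>t. 1 \<le> t \<Longrightarrow> t \<le> n \<Longrightarrow> 1 \<le> j t"
    and step: "\<And>t. j (Suc t) = j t \<or> j (Suc t) = Suc (j t)"
  shows "last_before bad q n = last_before bad p m"
proof -
  have mono: "j s \<le> j t" if "s \<le> t" for s t
    using that step by (metis lift_Suc_mono_le le_refl le_SucI)
  \<comment> \<open>Discrete intermediate values: starting at 0 and moving by steps of at most one,
    \<open>j\<close> skips nothing.\<close>
  have onto: "\<exists>t \<le> u. j t = s" if "s \<le> j u" for s u
    using that
  proof (induction u)
    case 0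
    then show ?case using j0 by auto
  next
    case (Suc u)
    then show ?case using step[of u] by (metis le_Suc_eq order_refl)
  qed
  let ?Q = "\<lambda>t. t \<in> {1..n} \<and> bad (q t)"
  let ?P = "\<lambda>s. s \<in> {1..m} \<and> bad (p s)"
  have QP: "?P (j t)" if "?Q t" for t
    using that q pos mono[of t n] jn by auto
  have PQ: "\<exists>t. ?Q t \<and> j t = s" if s: "?P s" for s
  proof -
    obtain t where "t \<le> n" "j t = s" using onto[of s n] s jn by (metis atLeastAtMost_iff)
    moreover from this have "t \<noteq> 0" using j0 s by (cases "t = 0") auto
    ultimately show ?thesis using q s by (intro exI[of _ t]) auto
  qed
  show ?thesis
  proof (cases "\<exists>t. ?Q t")
    case False
    have "last_before bad q n = q n"
      using False unfolding last_before_def by (rule if_not_P)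
    moreover have "\<not> (\<exists>s. ?P s)" using PQ False by blast
    then have "last_before bad p m = p m"
      unfolding last_before_def by (rule if_not_P)
    ultimately show ?thesis using q jn by simp
  next
    case True
    define t where "t = (LEAST t. ?Q t)"
    have t: "?Q t" unfolding t_def using True by (rule LeastI_ex)
    have least: "t \<le> t'" if "?Q t'" for t' unfolding t_def using that by (rule Least_le)
    have "(LEAST s. ?P s) = j t"
    proof (rule Least_equality)
      show "?P (j t)" using QP t by blast
      show "j t \<le> s" if "?P s" for s using PQ[OF that] least mono by blast
    qed
    \<comment> \<open>At the first bad time \<open>j\<close> must just have advanced. Otherwise
      \<open>q (t - 1)\<close> would be bad as well, at a time that is still positive because
      \<open>j 0 = 0\<close> and \<open>1 \<le> j t\<close>.\<close>
    moreover have "j t = Suc (j (t - 1))"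
    proof (rule ccontr)
      assume "j t \<noteq> Suc (j (t - 1))"
      then have eq: "j (t - 1) = j t" using step[of "t - 1"] t by auto
      then have "t - 1 \<noteq> 0" using j0 pos[of t] t by auto
      moreover have "bad (q (t - 1))" using eq q t by auto
      ultimately have "?Q (t - 1)" using t by auto
      then show False using least[of "t - 1"] t by auto
    qed
    moreover have "last_before bad q n = q (t - 1)"
      using True unfolding last_before_def t_def by (rule if_P)
    moreover have "\<exists>s. ?P s" using QP True by blast
    then have "last_before bad p m = p ((LEAST s. ?P s) - 1)"
      unfolding last_before_def by (rule if_P)
    moreover have "q (t - 1) = p (j (t - 1))" using q t by auto
    ultimately show ?thesis by simp
  qed
qed


section \<open>The ordering of all pairs\<close>

text \<open>Ties are broken in favour of \<open>H\<close>. The last conclusion records the effect: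
  an entry outside \<open>H\<close> comes after all members of \<open>H\<close> of no larger weight,
  equal weight included.\<close>

lemma sorted_extension:
  fixes w :: "'b \<Rightarrow> real"
  assumes "finite F" "set H \<subseteq> F" "distinct H" "sorted (map w H)"
  obtains L where "set L = F" "distinct L" "sorted (map w L)" "filter (\<lambda>x. x \<in> set H) L = H"
    "\<forall>i < length L. L ! i \<notin> set H \<longrightarrow> {x \<in> set H. w x \<le> w (L ! i)} \<subseteq> set (take i L)"
proof -
  obtain R where R: "set R = F - set H" "distinct R"
    using finite_distinct_list[of "F - set H"] assms(1) by auto
  \<comment> \<open>In the lexicographic order \<open>False < True\<close>, so among equal weights
    the members of \<open>H\<close> come first.\<close>
  define key where "key x = (w x, x \<notin> set H)" for x
  define L where "L = sort_key key (H @ R)"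
  have setL: "set L = F" using R assms by (auto simp: L_def)
  have sorted: "sorted (map key L)" by (simp add: L_def)
  have "sorted (map w L)"
    using sorted unfolding sorted_map by (rule sorted_wrt_mono_rel[rotated]) (auto simp: key_def)
  moreover have "filter (\<lambda>x. x \<in> set H) L = H"
  proof -
    have "sorted_wrt (\<lambda>x y. key x \<le> key y) H"
      using assms(4) unfolding sorted_map
      by (rule sorted_wrt_mono_rel[rotated]) (auto simp: key_def)
    then have "sort_key key H = H" by (simp add: sorted_map sort_key_id_if_sorted)
    moreover have "filter (\<lambda>x. x \<in> set H) (H @ R) = H"
      using R by (simp add: filter_empty_conv)
    \<comment> \<open>Filtering commutes with the stable sort, and \<open>H\<close> is already
      sorted by \<open>key\<close>, so even its order among ties survives.\<close>
    ultimately show ?thesis by (simp add: L_def filter_sort del: filter_append)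
  qed
  moreover have "x \<in> set (take i L)"
    if i: "i < length L" "L ! i \<notin> set H" and x: "x \<in> set H" "w x \<le> w (L ! i)" for i x
  proof -
    have "x \<in> set L" using x setL assms(2) by auto
    then obtain k where k: "k < length L" "L ! k = x" by (auto simp: in_set_conv_nth)
    have "key x < key (L ! i)" using i x by (auto simp: key_def)
    then have "k < i"
      using sorted_nth_mono[OF sorted, of i k] k i by (cases "k < i") auto
    then show ?thesis using k by (auto simp: in_set_conv_nth)
  qed
  moreover have "distinct L" using R assms(3) by (auto simp: L_def)
  ultimately show ?thesis
    using setL by (intro that[of L]) auto
qed

theorem theorem4p1:
  fixes V :: "'a set" and E :: "'a set set"
    and cen :: "'a \<Rightarrow> real" and C Cs :: "'a set \<Rightarrow> real"
    and H :: "'a set list"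
  assumes "simple_graph V E"
    and "\<forall>e\<in>E. C e > 0"
    and "(\<Sum>e\<in>E. C e) = 1"
    and "\<forall>e\<in>nonadjacent_pairs V E. Cs e \<ge> 0"
    and "(\<Sum>e\<in>nonadjacent_pairs V E. Cs e) = 1"
    and "minimum_spanning_forest (two_hop E) (pair_weight cen) (set H)"
    and "distinct H"
    and "sorted (map (pair_weight cen) H)"
  shows "\<forall>\<tau>. \<exists>L. set L = two_hop E \<and> distinct L \<and> sorted (map (pair_weight cen) L) \<and>
           greedy_summary V E C Cs H \<tau> = greedy_summary V E C Cs L \<tau>"
proof
  fix \<tau>
  let ?F = "two_hop E" and ?w = "pair_weight cen"
  have pairs: "\<forall>e\<in>?F. e \<subseteq> V \<and> card e = 2"
    using assms(1) by (auto simp: two_hop_def simple_graph_def)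
  then have "?F \<subseteq> Pow V" by blast
  then have "finite ?F"
    using assms(1) by (meson finite_Pow_iff finite_subset simple_graph_def)
  have HF: "set H \<subseteq> ?F"
    using assms(6) by (auto simp: minimum_spanning_forest_def spanning_forest_def)
  obtain L where L: "set L = ?F" "distinct L" "sorted (map ?w L)"
    and filterL: "filter (\<lambda>x. x \<in> set H) L = H"
    and early: "\<forall>i < length L. L ! i \<notin> set H \<longrightarrow>
        {x \<in> set H. ?w x \<le> ?w (L ! i)} \<subseteq> set (take i L)"
    by (rule sorted_extension[OF \<open>finite ?F\<close> HF assms(7,8)])
  \<comment> \<open>The pace of the stuttering: the number of forest edges among the first
    \<open>t\<close> entries of \<open>L\<close>.\<close>
  define j where "j t = length (filter (\<lambda>x. x \<in> set H) (take t L))" for t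

  \<comment> \<open>The light forest edges connecting the ends of a pair outside the forest all
    precede it in \<open>L\<close>, so merging along it has no effect.\<close>
  have redundant: "connected_by (set (take i L) \<inter> set H) a c"
    if "i < length L" "L ! i = {a, c}" "{a, c} \<notin> set H" for i a c
  proof -
    have "{a, c} \<in> ?F" using that L(1) nth_mem by metis
    then have "connected_by {f \<in> set H. ?w f \<le> ?w {a, c}} a c"
      using minimum_spanning_forest_connects_light[OF assms(6) \<open>finite ?F\<close>] pairs by simp
    moreover have "{f \<in> set H. ?w f \<le> ?w {a, c}} \<subseteq> set (take i L) \<inter> set H"
      using early[rule_format, of i] that by auto
    ultimately show ?thesis by (rule connected_by_mono[rotated])
  qed
  have same: "components_of V (set (take t L)) = components_of V (set (take t L) \<inter> set H)" for t
  proof -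
    have "connected_by (set (take t L) \<inter> set H) a c" if ac: "{a, c} \<in> set (take t L)" for a c
    proof (cases "{a, c} \<in> set H")
      case True
      then show ?thesis using ac by (intro connected_by_edge) simp
    next
      case False
      obtain i where i: "i < length L" "i < t" "L ! i = {a, c}"
        using ac by (auto simp: in_set_conv_nth)
      have "set (take i L) \<subseteq> set (take t L)" using i by (simp add: set_take_subset_set_take)
      then show ?thesis
        by (intro connected_by_mono[OF _ redundant[OF i(1,3) False]]) auto
    qed
    then have "connected_by (set (take t L)) u v \<longleftrightarrow>
        connected_by (set (take t L) \<inter> set H) u v" for u v
      by (meson connected_by_subst connected_by_mono Int_lower1)
    then show ?thesis by (simp add: components_of_def)
  qed
  \<comment> \<open>The forest edges of \<open>L\<close> appear in the order of \<open>H\<close>, so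
    those met within the first \<open>t\<close> entries form an initial segment of
    \<open>H\<close>.\<close>
  have prefix: "set (take t L) \<inter> set H = set (take (j t) H)" for t
  proof -
    have "H = filter (\<lambda>x. x \<in> set H) (take t L) @ filter (\<lambda>x. x \<in> set H) (drop t L)"
      using filterL by (metis append_take_drop_id filter_append)
    then have "take (j t) H = filter (\<lambda>x. x \<in> set H) (take t L)"
      unfolding j_def by (metis append_eq_conv_conj)
    then show ?thesis by auto
  qed
  have after: "partition_after V M t = components_of V (set (take t M))" if "set M \<subseteq> ?F" for M t
    unfolding partition_after_def
    by (rule foldl_merge) (use that pairs in \<open>meson in_set_takeD subsetD\<close>)
  have stutter: "partition_after V L t = partition_after V H (j t)" for t
    using same prefix after HF L(1) by simp
  have "last_before bad (partition_after V L) (length L) =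
      last_before bad (partition_after V H) (length H)" for bad
  proof (rule last_before_stutter[where j = j])
    \<comment> \<open>The first entry of \<open>L\<close> is a forest edge: otherwise
      \<open>redundant\<close> at position 0 would connect its two distinct ends by the empty edge
      set.\<close>
    show "1 \<le> j t" if t: "1 \<le> t" "t \<le> length L" for t
    proof -
      have "0 < length L" using t by linarith
      then have "L ! 0 \<in> ?F" using L(1) nth_mem by metis
      then obtain a c where ac: "L ! 0 = {a, c}" "a \<noteq> c" using pairs by (auto simp: card_2_iff)
      then have "L ! 0 \<in> set H"
        using redundant[of 0 a c] \<open>0 < length L\<close> by (auto simp: connected_by_empty)
      moreover have "take t L ! 0 \<in> set (take t L)" using t by (intro nth_mem) simp
      then have "L ! 0 \<in> set (take t L)" using t by simp
      ultimately have "filter (\<lambda>x. x \<in> set H) (take t L) \<noteq> []" by (auto simp: filter_empty_conv)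
      then show ?thesis unfolding j_def by (simp add: Suc_le_eq)
    qed
    \<comment> \<open>Beyond the end of \<open>L\<close>, \<open>take\<close> no longer grows and
      \<open>j\<close> stays constant.\<close>
    show "j (Suc t) = j t \<or> j (Suc t) = Suc (j t)" for t
      by (cases "t < length L") (auto simp: j_def take_Suc_conv_app_nth)
  qed (use stutter filterL in \<open>auto simp: j_def\<close>)
  then show "\<exists>L. set L = ?F \<and> distinct L \<and> sorted (map ?w L) \<and>
      greedy_summary V E C Cs H \<tau> = greedy_summary V E C Cs L \<tau>"
    using L by (auto simp: greedy_summary_last_before)
qed

end
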